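(* Let an $N$-player linear-quadratic generalized Nash game with shared affine constraints be given as in the context, with monotone pseudogradient $\phi(x)=Fx+f$, and let $F_s=\tfrac12(F+F^\top)$. Let $\rho>0$ and assume that there exists a v-GNE primal-dual triple $(x^\star,\lambda^\star,\nu^\star)$, i.e. a triple satisfying the joint KKT conditions of the game. Let $(x(\rho),\lambda(\rho),\nu(\rho))$ be the unique solution of the strongly convex quadratic program $$ \begin{aligned} \min_{x,\lambda,\nu}\quad & x^\top F_s x+f^\top x+b^\top\lambda+e^\top\nu+\tfrac{\rho}{2}\bigl(\|x\|^2+\|\lambda\|^2+\|\nu\|^2\bigr)\\ \text{s.t.}\quad & Fx+f+A^\top\lambda+E^\top\nu=0,\\ & Ex=e,\quad Ax\le b,\quad \lambda\ge 0. \end{aligned} $$ Then $x(\rho)\in\mathcal{X}$, and $x(\rho)$ is an $\varepsilon(\rho)$-approximated generalized Nash equilibrium of the game with $$ \varepsilon(\rho)=\lambda(\rho)^\top\bigl(b-Ax(\rho)\bigr)\le\frac{\rho}{2}\bigl(\|x^\star\|^2+\|\lambda^\star\|^2+\|\nu^\star\|^2\bigr). $$ In particular, $\varepsilon(\rho)=\mathcal{O}(\rho)$ as $\rho\to 0$.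
   Context: Game. There are $N$ players; player $i\in\{1,\dots,N\}$ chooses $x_i\in\mathbb{R}^{n_i}$, and $x=(x_1,\dots,x_N)\in\mathbb{R}^n$, $n=\sum_i n_i$; $x_{-i}$ denotes all components of $x$ other than $x_i$, and $x=(x_i,x_{-i})$. Player $i$ minimizes over $x_i$ the cost $J_i(x)=\tfrac12 x^\top Q^{(i)}x+(c^{(i)})^\top x$, with $Q^{(i)}\in\mathbb{R}^{n\times n}$ symmetric and $c^{(i)}\in\mathbb{R}^n$, subject to the shared constraint $x\in\mathcal{X}=\{x\in\mathbb{R}^n: Ax\le b,\ Ex=e\}$, where $A\in\mathbb{R}^{m\times n}$, $b\in\mathbb{R}^m$, $E\in\mathbb{R}^{q\times n}$, $e\in\mathbb{R}^q$, $m,q\ge 0$. Vector inequalities are componentwise; $\|\cdot\|$ is the Euclidean norm. Pseudogradient. $\phi(x)=Fx+f$, obtained by stacking $\nabla_{x_i}J_i(x)$, i.e. the $i$-th block of rows of $F\in\mathbb{R}^{n\times n}$ (the $n_i$ rows indexed by the coordinates of $x_i$) equals the $i$-th block of rows of $Q^{(i)}$, and the $i$-th block of $f\in\mathbb{R}^n$ equals the $i$-th block of $c^{(i)}$. Standing assumption. $\phi$ is monotone: $(\phi(x)-\phi(y))^\top(x-y)\ge 0$ for all $x,y\in\mathbb{R}^n$ (equivalently $F_s\succeq 0$). Joint KKT conditions. A triple $(x^\star,\lambda^\star,\nu^\star)\in\mathbb{R}^n\times\mathbb{R}^m\times\mathbb{R}^q$ satisfies the joint KKT conditions of the game if $Fx^\star+f+A^\top\lambda^\star+E^\top\nu^\star=0$,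 $Ex^\star=e$, $Ax^\star\le b$, $\lambda^\star\ge 0$, and $(\lambda^\star)^\top(Ax^\star-b)=0$. $\varepsilon$-approximated GNE. A point $x^\varepsilon\in\mathcal{X}$ is an $\varepsilon$-approximated generalized Nash equilibrium if for every player $i$ and every $z_i\in\mathbb{R}^{n_i}$ with $(z_i,x^\varepsilon_{-i})\in\mathcal{X}$ one has $J_i(x_i^\varepsilon,x_{-i}^\varepsilon)\le J_i(z_i,x_{-i}^\varepsilon)+\varepsilon$. *)

theory Defs
  imports "HOL-Library.Landau_Symbols" "Jordan_Normal_Form.Matrix"
begin

text \<open>Vectors and matrices are those of \<^theory>\<open>Jordan_Normal_Form.Matrix\<close>: their dimensions are
  natural numbers that may be zero (so absent inequality or equality constraints are covered),
  \<open>\<le>\<close> on vectors is componentwise, and \<open>\<bullet>\<close> is the scalar product.\<close>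

definition vec_norm :: "real vec \<Rightarrow> real" where
  "vec_norm v = sqrt (v \<bullet> v)"

text \<open>Players are numbered from \<open>0\<close>. The numbers of inequality and equality constraints
  are the dimensions of \<open>ineq_rhs\<close> and \<open>eq_rhs\<close>.\<close>

record lq_game =
  num_players :: nat
  block_dim :: "nat \<Rightarrow> nat"
  cost_mat :: "nat \<Rightarrow> real mat"
  cost_vec :: "nat \<Rightarrow> real vec"
  ineq_mat :: "real mat"
  ineq_rhs :: "real vec"
  eq_mat :: "real mat"
  eq_rhs :: "real vec"

text \<open>The coordinates of player \<open>i\<close> in a joint strategy are those \<open>k\<close> with
  \<open>offset G i \<le> k < offset G (Suc i)\<close>.\<close>

definition offset :: "lq_game \<Rightarrow> nat \<Rightarrow> nat" where
  "offset G i = (\<Sum>j<i. block_dim G j)"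

definition total_dim :: "lq_game \<Rightarrow> nat" where
  "total_dim G = (\<Sum>i<num_players G. block_dim G i)"

definition owner :: "lq_game \<Rightarrow> nat \<Rightarrow> nat" where
  "owner G k = (THE i. i < num_players G \<and> offset G i \<le> k \<and> k < offset G (Suc i))"

definition valid_game :: "lq_game \<Rightarrow> bool" where
  "valid_game G \<longleftrightarrow>
     (\<forall>i<num_players G.
        cost_mat G i \<in> carrier_mat (total_dim G) (total_dim G) \<and>
        (cost_mat G i)\<^sup>T = cost_mat G i \<and>
        cost_vec G i \<in> carrier_vec (total_dim G)) \<and>
     ineq_mat G \<in> carrier_mat (dim_vec (ineq_rhs G)) (total_dim G) \<and>
     eq_mat G \<in> carrier_mat (dim_vec (eq_rhs G)) (total_dim G)"

definition cost :: "lq_game \<Rightarrow> nat \<Rightarrow> real vec \<Rightarrow> real" where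
  "cost G i x = 1 / 2 * (x \<bullet> (cost_mat G i *\<^sub>v x)) + cost_vec G i \<bullet> x"

definition strategy_set :: "lq_game \<Rightarrow> real vec set" where
  "strategy_set G = {x \<in> carrier_vec (total_dim G).
     ineq_mat G *\<^sub>v x \<le> ineq_rhs G \<and> eq_mat G *\<^sub>v x = eq_rhs G}"

text \<open>The joint strategy \<open>(z, x\<^sub>-\<^sub>i)\<close>.\<close>

definition deviate :: "lq_game \<Rightarrow> nat \<Rightarrow> real vec \<Rightarrow> real vec \<Rightarrow> real vec" where
  "deviate G i z x = vec (total_dim G) (\<lambda>k.
     if offset G i \<le> k \<and> k < offset G (Suc i) then z $ (k - offset G i) else x $ k)"

definition approx_GNE :: "lq_game \<Rightarrow> real \<Rightarrow> real vec \<Rightarrow> bool" where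
  "approx_GNE G \<epsilon> x \<longleftrightarrow> x \<in> strategy_set G \<and>
     (\<forall>i<num_players G. \<forall>z \<in> carrier_vec (block_dim G i).
        deviate G i z x \<in> strategy_set G \<longrightarrow>
        cost G i x \<le> cost G i (deviate G i z x) + \<epsilon>)"

definition pg_mat :: "lq_game \<Rightarrow> real mat" where
  "pg_mat G = mat (total_dim G) (total_dim G) (\<lambda>(r, s). cost_mat G (owner G r) $$ (r, s))"

definition pg_vec :: "lq_game \<Rightarrow> real vec" where
  "pg_vec G = vec (total_dim G) (\<lambda>r. cost_vec G (owner G r) $ r)"

definition pseudogradient :: "lq_game \<Rightarrow> real vec \<Rightarrow> real vec" where
  "pseudogradient G x = pg_mat G *\<^sub>v x + pg_vec G"

definition monotone_game :: "lq_game \<Rightarrow> bool" where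
  "monotone_game G \<longleftrightarrow>
     (\<forall>x \<in> carrier_vec (total_dim G). \<forall>y \<in> carrier_vec (total_dim G).
        (pseudogradient G x - pseudogradient G y) \<bullet> (x - y) \<ge> 0)"

definition pg_sym :: "lq_game \<Rightarrow> real mat" where
  "pg_sym G = (1 / 2) \<cdot>\<^sub>m (pg_mat G + (pg_mat G)\<^sup>T)"

lemma owner_eq:
  assumes "i < num_players G" "offset G i \<le> k" "k < offset G (Suc i)"
  shows "owner G k = i"
proof -
  have mono: "offset G a \<le> offset G b" if "a \<le> b" for a b
    unfolding offset_def using that by (intro sum_mono2) auto
  show ?thesis
    unfolding owner_def
  proof (rule the_equality)
    fix j assume j: "j < num_players G \<and> offset G j \<le> k \<and> k < offset G (Suc j)"
    show "j = i"
      using mono[of "Suc j" i] mono[of "Suc i" j] j assms by (cases j i rule: linorder_cases) auto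
  qed (use assms in auto)
qed

lemma offset_le_total_dim: "i < num_players G \<Longrightarrow> offset G (Suc i) \<le> total_dim G"
  unfolding offset_def total_dim_def by (intro sum_mono2) auto

lemma row_pg_mat:
  assumes "valid_game G" "i < num_players G" "offset G i \<le> k" "k < offset G (Suc i)"
  shows "row (pg_mat G) k = row (cost_mat G i) k"
proof -
  have "k < total_dim G"
    using assms offset_le_total_dim[of i G] by simp
  moreover have "cost_mat G i \<in> carrier_mat (total_dim G) (total_dim G)"
    using assms by (auto simp: valid_game_def)
  ultimately show ?thesis
    using owner_eq[OF assms(2-4)] by (intro eq_vecI) (auto simp: pg_mat_def)
qed

text \<open>Primal-dual triples are \<open>(x, l, v)\<close>, where \<open>l\<close> and \<open>v\<close> are the multipliers of the
  inequality and the equality constraints.\<close>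

definition primal_dual_space :: "lq_game \<Rightarrow> (real vec \<times> real vec \<times> real vec) set" where
  "primal_dual_space G = carrier_vec (total_dim G) \<times>
     carrier_vec (dim_vec (ineq_rhs G)) \<times> carrier_vec (dim_vec (eq_rhs G))"

definition qp_feasible :: "lq_game \<Rightarrow> real vec \<times> real vec \<times> real vec \<Rightarrow> bool" where
  "qp_feasible G = (\<lambda>(x, l, v).
     (x, l, v) \<in> primal_dual_space G \<and>
     pg_mat G *\<^sub>v x + pg_vec G + (ineq_mat G)\<^sup>T *\<^sub>v l + (eq_mat G)\<^sup>T *\<^sub>v v = 0\<^sub>v (total_dim G) \<and>
     eq_mat G *\<^sub>v x = eq_rhs G \<and>
     ineq_mat G *\<^sub>v x \<le> ineq_rhs G \<and>
     0\<^sub>v (dim_vec (ineq_rhs G)) \<le> l)"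

definition joint_KKT :: "lq_game \<Rightarrow> real vec \<times> real vec \<times> real vec \<Rightarrow> bool" where
  "joint_KKT G = (\<lambda>(x, l, v).
     (x, l, v) \<in> primal_dual_space G \<and>
     pg_mat G *\<^sub>v x + pg_vec G + (ineq_mat G)\<^sup>T *\<^sub>v l + (eq_mat G)\<^sup>T *\<^sub>v v = 0\<^sub>v (total_dim G) \<and>
     eq_mat G *\<^sub>v x = eq_rhs G \<and>
     ineq_mat G *\<^sub>v x \<le> ineq_rhs G \<and>
     0\<^sub>v (dim_vec (ineq_rhs G)) \<le> l \<and>
     l \<bullet> (ineq_mat G *\<^sub>v x - ineq_rhs G) = 0)"

definition qp_objective :: "lq_game \<Rightarrow> real \<Rightarrow> real vec \<times> real vec \<times> real vec \<Rightarrow> real" where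
  "qp_objective G \<rho> = (\<lambda>(x, l, v).
     x \<bullet> (pg_sym G *\<^sub>v x) + pg_vec G \<bullet> x + ineq_rhs G \<bullet> l + eq_rhs G \<bullet> v
     + \<rho> / 2 * ((vec_norm x)\<^sup>2 + (vec_norm l)\<^sup>2 + (vec_norm v)\<^sup>2))"

definition is_qp_solution :: "lq_game \<Rightarrow> real \<Rightarrow> real vec \<times> real vec \<times> real vec \<Rightarrow> bool" where
  "is_qp_solution G \<rho> p \<longleftrightarrow> is_arg_min (qp_objective G \<rho>) (qp_feasible G) p"

definition qp_solution :: "lq_game \<Rightarrow> real \<Rightarrow> real vec \<times> real vec \<times> real vec" where
  "qp_solution G \<rho> = (THE p. is_qp_solution G \<rho> p)"

definition eps :: "lq_game \<Rightarrow> real \<Rightarrow> real" where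
  "eps G \<rho> = (case qp_solution G \<rho> of (x, l, v) \<Rightarrow> l \<bullet> (ineq_rhs G - ineq_mat G *\<^sub>v x))"

end

theory Submission
  imports Defs
begin

text \<open>On the feasible set of the quadratic program, stationarity turns the unregularized part of the
  objective into the complementarity gap \<open>l \<bullet> (b - A x)\<close>, which is nonnegative there and zero at a
  KKT triple. Comparing the objective at the minimizer with its value at the KKT triple bounds the
  gap. For a unilateral deviation \<open>y = x + d\<close> of player \<open>i\<close> the second-order term
  \<open>d \<bullet> Q\<^sup>(\<^sup>i\<^sup>) d = d \<bullet> F d\<close> is nonnegative by monotonicity, and the first-order term is
  \<open>d \<bullet> \<phi>(x) = - l \<bullet> (A y - A x) \<ge> - l \<bullet> (b - A x)\<close>. Strong convexity makes every minimizing
  sequence Cauchy, which gives existence and uniqueness of the minimizer without compactness.\<close>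

section \<open>Scalar products of real vectors and componentwise order\<close>

lemma vec_norm_square: "(vec_norm x)\<^sup>2 = x \<bullet> x"
  by (simp add: vec_norm_def scalar_prod_def sum_nonneg)

lemma scalar_prod_self_nonneg: "(x :: real vec) \<bullet> x \<ge> 0"
  by (simp add: scalar_prod_def sum_nonneg)

lemma square_index_le_scalar_prod:
  fixes x :: "real vec"
  assumes "x \<in> carrier_vec n" "i < n"
  shows "(x $ i)\<^sup>2 \<le> x \<bullet> x"
proof -
  have "(x $ i)\<^sup>2 \<le> (\<Sum>i<n. (x $ i)\<^sup>2)"
    using assms by (intro member_le_sum) auto
  then show ?thesis
    using assms by (simp add: scalar_prod_def power2_eq_square atLeast0LessThan)
qed

lemma scalar_prod_le_mono:
  fixes l :: "real vec"
  assumes "0\<^sub>v n \<le> l" "x \<le> y" "y \<in> carrier_vec n"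
  shows "l \<bullet> x \<le> l \<bullet> y"
  using assms by (auto simp: scalar_prod_def less_eq_vec_def intro!: sum_mono mult_left_mono)

section \<open>Midpoints of vectors\<close>

definition vec_mid :: "real vec \<Rightarrow> real vec \<Rightarrow> real vec" where
  "vec_mid x y = (1 / 2) \<cdot>\<^sub>v (x + y)"

lemma vec_mid_carrier [simp]:
  "x \<in> carrier_vec n \<Longrightarrow> y \<in> carrier_vec n \<Longrightarrow> vec_mid x y \<in> carrier_vec n"
  by (simp add: vec_mid_def)

lemma vec_mid_same: "x \<in> carrier_vec n \<Longrightarrow> vec_mid x x = x"
  by (intro eq_vecI) (auto simp: vec_mid_def)

lemma mult_mat_vec_mid:
  fixes M :: "real mat"
  assumes "M \<in> carrier_mat r n" "x \<in> carrier_vec n" "y \<in> carrier_vec n"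
  shows "M *\<^sub>v vec_mid x y = vec_mid (M *\<^sub>v x) (M *\<^sub>v y)"
  using assms by (simp add: vec_mid_def mult_mat_vec[of M r n] mult_add_distrib_mat_vec[of M r n])

lemma vec_mid_add:
  assumes "x \<in> carrier_vec n" "y \<in> carrier_vec n" "x' \<in> carrier_vec n" "y' \<in> carrier_vec n"
  shows "vec_mid (x + x') (y + y') = vec_mid x y + vec_mid x' y'"
  using assms by (intro eq_vecI) (auto simp: vec_mid_def field_simps)

lemma vec_mid_mono:
  assumes "x \<le> x'" "y \<le> y'" "x' \<in> carrier_vec n" "y' \<in> carrier_vec n"
  shows "vec_mid x y \<le> vec_mid x' y'"
  using assms by (auto simp: less_eq_vec_def vec_mid_def intro!: add_mono)

lemma scalar_prod_mid:
  assumes "a \<in> carrier_vec n" "x \<in> carrier_vec n" "y \<in> carrier_vec n"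
  shows "a \<bullet> vec_mid x y = (a \<bullet> x + a \<bullet> y) / 2"
  using assms by (simp add: vec_mid_def scalar_prod_add_distrib[of _ n])

lemma quadratic_form_mid:
  \<comment> \<open>The parallelogram identity for a bilinear form. The cross terms occur on both
    sides only as the sum of \<open>x \<bullet> (M *\<^sub>v y)\<close> and
    \<open>y \<bullet> (M *\<^sub>v x)\<close>, so it applies directly to the possibly nonsymmetric
    pseudogradient matrix. The subtracted term is the source of strong convexity.\<close>
  fixes M :: "real mat"
  assumes [simp]: "M \<in> carrier_mat n n" "x \<in> carrier_vec n" "y \<in> carrier_vec n"
  shows "vec_mid x y \<bullet> (M *\<^sub>v vec_mid x y) =
    (x \<bullet> (M *\<^sub>v x) + y \<bullet> (M *\<^sub>v y)) / 2 - ((x - y) \<bullet> (M *\<^sub>v (x - y))) / 4"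
proof -
  have [simp]: "M *\<^sub>v x \<in> carrier_vec n" "M *\<^sub>v y \<in> carrier_vec n"
    by (simp_all add: mult_mat_vec_carrier[of M n n])
  have [simp]: "dim_row M = n" "dim_vec x = n" "dim_vec y = n"
    using carrier_matD[OF assms(1)] carrier_vecD[OF assms(2)] carrier_vecD[OF assms(3)] by blast+
  show ?thesis
    by (simp add: vec_mid_def mult_mat_vec[of M n n] mult_add_distrib_mat_vec[of M n n]
        mult_minus_distrib_mat_vec[of M n n] scalar_prod_add_distrib[of _ n]
        add_scalar_prod_distrib[of _ n] scalar_prod_minus_distrib[of _ n]
        minus_scalar_prod_distrib[of _ n] field_simps)
qed

lemma scalar_prod_self_mid:
  assumes "x \<in> carrier_vec n" "y \<in> carrier_vec n"
  shows "vec_mid x y \<bullet> vec_mid x y = (x \<bullet> x + y \<bullet> y) / 2 - ((x - y) \<bullet> (x - y)) / 4"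
  using quadratic_form_mid[of "1\<^sub>m n" n x y] assms by simp

section \<open>Coordinatewise limits in a fixed dimension\<close>

text \<open>The carrier conditions belong to the notion because \<open>real vec\<close> contains
  vectors of every dimension. In finite dimension this is convergence in norm, and dimension zero is
  included.\<close>

definition vec_lim :: "nat \<Rightarrow> (nat \<Rightarrow> real vec) \<Rightarrow> real vec \<Rightarrow> bool" where
  "vec_lim n u x \<longleftrightarrow> (\<forall>k. u k \<in> carrier_vec n) \<and> x \<in> carrier_vec n \<and>
     (\<forall>i<n. (\<lambda>k. u k $ i) \<longlonglongrightarrow> x $ i)"

lemma vec_lim_const: "x \<in> carrier_vec n \<Longrightarrow> vec_lim n (\<lambda>k. x) x"
  by (simp add: vec_lim_def)

lemma vec_lim_add: "vec_lim n u x \<Longrightarrow> vec_lim n w y \<Longrightarrow> vec_lim n (\<lambda>k. u k + w k) (x + y)"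
  unfolding vec_lim_def
proof (safe intro!: add_carrier_vec)
  fix i assume "i < n" "\<forall>i<n. (\<lambda>k. u k $ i) \<longlonglongrightarrow> x $ i" "\<forall>i<n. (\<lambda>k. w k $ i) \<longlonglongrightarrow> y $ i"
    and w: "\<forall>k. w k \<in> carrier_vec n" "y \<in> carrier_vec n"
  then have "(\<lambda>k. u k $ i + w k $ i) \<longlonglongrightarrow> x $ i + y $ i"
    by (intro tendsto_add) auto
  moreover have "(u k + w k) $ i = u k $ i + w k $ i" "(x + y) $ i = x $ i + y $ i" for k
    using w \<open>i < n\<close> carrier_vecD by (metis index_add_vec(1))+
  ultimately show "(\<lambda>k. (u k + w k) $ i) \<longlonglongrightarrow> (x + y) $ i"
    by simp
qed auto

lemma tendsto_scalar_prod:
  assumes "vec_lim n u x" "vec_lim n w y"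
  shows "(\<lambda>k. u k \<bullet> w k) \<longlonglongrightarrow> x \<bullet> y"
proof -
  have dims: "dim_vec (w k) = n" "dim_vec y = n" for k
    using assms by (auto simp: vec_lim_def)
  show ?thesis
    using assms unfolding scalar_prod_def dims
    by (intro tendsto_sum tendsto_mult) (auto simp: vec_lim_def)
qed

lemma vec_lim_mult_mat_vec:
  assumes "M \<in> carrier_mat r n" "vec_lim n u x"
  shows "vec_lim r (\<lambda>k. M *\<^sub>v u k) (M *\<^sub>v x)"
proof -
  have "(\<lambda>k. row M i \<bullet> u k) \<longlonglongrightarrow> row M i \<bullet> x" if "i < r" for i
    using that assms by (intro tendsto_scalar_prod[of n] vec_lim_const) auto
  then show ?thesis
    using assms by (auto simp: vec_lim_def)
qed

lemma vec_lim_unique: "vec_lim n u x \<Longrightarrow> vec_lim n u y \<Longrightarrow> x = y"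
  unfolding vec_lim_def by (metis LIMSEQ_unique carrier_vecD eq_vecI)

lemma vec_lim_le:
  assumes "vec_lim n u x" "vec_lim n w y" "\<And>k. u k \<le> w k"
  shows "x \<le> y"
proof -
  have "x $ i \<le> y $ i" if i: "i < n" for i
  proof (rule LIMSEQ_le)
    show "(\<lambda>k. u k $ i) \<longlonglongrightarrow> x $ i" "(\<lambda>k. w k $ i) \<longlonglongrightarrow> y $ i"
      using assms i by (auto simp: vec_lim_def)
    have "u k $ i \<le> w k $ i" for k
    proof -
      have "dim_vec (w k) = n"
        using assms(2) by (auto simp: vec_lim_def)
      then show ?thesis
        using assms(3)[of k] i by (auto simp: less_eq_vec_def)
    qed
    then show "\<exists>N. \<forall>k\<ge>N. u k $ i \<le> w k $ i"
      by blast
  qed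
  then show ?thesis
    using assms by (auto simp: vec_lim_def less_eq_vec_def)
qed

text \<open>Each coordinate is a real Cauchy sequence, hence convergent. The bound \<open>D\<close>
  is left free so that one squared distance between triples can control all three of their
  components.\<close>

lemma Cauchy_imp_vec_lim:
  assumes u: "\<And>k. u k \<in> carrier_vec n"
    and le: "\<And>j k. (u j - u k) \<bullet> (u j - u k) \<le> D j k"
    and C: "\<And>e. e > 0 \<Longrightarrow> \<exists>N. \<forall>j\<ge>N. \<forall>k\<ge>N. D j k < e"
  shows "\<exists>x. vec_lim n u x"
proof -
  have "convergent (\<lambda>k. u k $ i)" if i: "i < n" for i
    unfolding Cauchy_convergent_iff[symmetric]
  proof (rule metric_CauchyI)
    fix e :: real assume e: "e > 0"
    \<comment> \<open>\<open>D\<close> bounds squared distances, hence the threshold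
      \<open>e\<^sup>2\<close>.\<close>
    then obtain N where N: "\<forall>j\<ge>N. \<forall>k\<ge>N. D j k < e\<^sup>2"
      using C[of "e\<^sup>2"] by auto
    have "dist (u j $ i) (u k $ i) < e" if "j \<ge> N" "k \<ge> N" for j k
    proof -
      have "((u j - u k) $ i)\<^sup>2 \<le> (u j - u k) \<bullet> (u j - u k)"
        using u i by (intro square_index_le_scalar_prod[of _ n]) auto
      also have "\<dots> \<le> D j k"
        by (rule le)
      also have "\<dots> < e\<^sup>2"
        using N that by auto
      finally have "\<bar>(u j - u k) $ i\<bar> < e"
        using power2_less_imp_less[of "\<bar>(u j - u k) $ i\<bar>" e] e by simp
      moreover have "(u j - u k) $ i = u j $ i - u k $ i"
        using u[of k] i by auto
      ultimately show ?thesis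
        by (simp add: dist_real_def)
    qed
    then show "\<exists>M. \<forall>m\<ge>M. \<forall>k\<ge>M. dist (u m $ i) (u k $ i) < e"
      by blast
  qed
  then have "vec_lim n u (vec n (\<lambda>i. lim (\<lambda>k. u k $ i)))"
    using u by (simp add: vec_lim_def convergent_LIMSEQ_iff)
  then show ?thesis
    by blast
qed

section \<open>Minimization of midpoint-convex functions\<close>

text \<open>Here \<open>d\<close> plays the role of a squared distance and \<open>mid\<close> that of the midpoint.\<close>

lemma ex1_is_arg_min_midpoint_convex:
  fixes h :: "'a \<Rightarrow> real" and d :: "'a \<Rightarrow> 'a \<Rightarrow> real"
  assumes ne: "S s"
    and nonneg: "\<And>p. S p \<Longrightarrow> 0 \<le> h p"
    and mid: "\<And>p q. S p \<Longrightarrow> S q \<Longrightarrow> S (mid p q)"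
    and convex: "\<And>p q. S p \<Longrightarrow> S q \<Longrightarrow> h (mid p q) \<le> (h p + h q) / 2 - c * d p q"
    and c: "c > 0"
    and sep: "\<And>p q. S p \<Longrightarrow> S q \<Longrightarrow> d p q \<le> 0 \<Longrightarrow> p = q"
    and compl: "\<And>u. (\<And>k. S (u k)) \<Longrightarrow>
      (\<And>e. e > 0 \<Longrightarrow> \<exists>N. \<forall>j\<ge>N. \<forall>k\<ge>N. d (u j) (u k) < e) \<Longrightarrow>
      \<exists>p. S p \<and> (\<lambda>k. h (u k)) \<longlonglongrightarrow> h p"
  shows "\<exists>!p. is_arg_min h S p"
proof -
  define m where "m = Inf (h ` Collect S)"
  have bdd: "bdd_below (h ` Collect S)"
    using nonneg by (intro bdd_belowI[of _ 0]) auto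
  have m_le: "m \<le> h p" if "S p" for p
    unfolding m_def using that by (intro cInf_lower bdd) auto
  \<comment> \<open>The midpoint also satisfies \<open>S\<close>, so its value is at least the
    infimum \<open>m\<close>. Solving the convexity inequality for \<open>d p q\<close> shows that
    two almost optimal points are close.\<close>
  have d_le: "d p q \<le> ((h p + h q) / 2 - m) / c" if "S p" "S q" for p q
    using convex[OF that] m_le[OF mid[OF that]] c by (simp add: field_simps)
  have "\<exists>p. S p \<and> h p < m + inverse (real (Suc k))" for k
    using cInf_lessD[of "h ` Collect S" "m + inverse (real (Suc k))"] ne m_def by auto
  then obtain u where u: "\<And>k. S (u k)" "\<And>k. h (u k) < m + inverse (real (Suc k))"
    by metis
  have Cauchy: "\<exists>N. \<forall>j\<ge>N. \<forall>k\<ge>N. d (u j) (u k) < e" if "e > 0" for e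
  proof -
    \<comment> \<open>\<open>d_le\<close> divides the mean excess over \<open>m\<close> by
      \<open>c\<close>; excesses below \<open>c * e\<close> therefore give distances below
      \<open>e\<close>.\<close>
    obtain N where N: "inverse (real (Suc N)) < c * e"
      using reals_Archimedean[of "c * e"] c \<open>e > 0\<close> by auto
    have "d (u j) (u k) < e" if "j \<ge> N" "k \<ge> N" for j k
    proof -
      have "h (u i) - m < c * e" if "i \<ge> N" for i
      proof -
        have "inverse (real (Suc i)) \<le> inverse (real (Suc N))"
          using that by (intro le_imp_inverse_le) auto
        then show ?thesis
          using u(2)[of i] N by linarith
      qed
      from this[OF \<open>j \<ge> N\<close>] this[OF \<open>k \<ge> N\<close>] have "(h (u j) + h (u k)) / 2 - m < c * e"
        by argo
      then have "((h (u j) + h (u k)) / 2 - m) / c < e"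
        using c by (simp add: divide_less_eq mult.commute)
      then show ?thesis
        using d_le[OF u(1) u(1), of j k] by linarith
    qed
    then show ?thesis
      by blast
  qed
  obtain p where p: "S p" "(\<lambda>k. h (u k)) \<longlonglongrightarrow> h p"
    using compl[of u, OF u(1) Cauchy] by blast
  have "(\<lambda>k. m + inverse (real (Suc k))) \<longlonglongrightarrow> m"
    using tendsto_add[OF tendsto_const LIMSEQ_inverse_real_of_nat] by simp
  then have "h p \<le> m"
    using u(2) by (intro LIMSEQ_le[OF p(2)]) (auto intro: less_imp_le)
  then have "h p = m"
    using m_le[OF p(1)] by simp
  show ?thesis
  proof
    show "is_arg_min h S p"
      using p(1) m_le \<open>h p = m\<close> by (auto simp: is_arg_min_linorder)
    fix q assume "is_arg_min h S q"
    then have "S q" "h q \<le> m"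
      using p(1) \<open>h p = m\<close> by (auto simp: is_arg_min_linorder)
    \<comment> \<open>Two minimizers both attain \<open>m\<close>, so the bound in
      \<open>d_le\<close> vanishes and \<open>sep\<close> identifies them.\<close>
    then have "((h q + h p) / 2 - m) / c \<le> 0"
      using c \<open>h p = m\<close> by (intro divide_nonpos_pos) auto
    then show "q = p"
      using d_le[OF \<open>S q\<close> p(1)] \<open>S q\<close> p(1) by (intro sep) auto
  qed
qed

section \<open>The pseudogradient matrix as a quadratic form\<close>

locale monotone_lq_game =
  fixes G :: lq_game
  assumes valid: "valid_game G" and monotone: "monotone_game G"
begin

abbreviation "n \<equiv> total_dim G"
abbreviation "m \<equiv> dim_vec (ineq_rhs G)"
abbreviation "q \<equiv> dim_vec (eq_rhs G)"
abbreviation "F \<equiv> pg_mat G"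
abbreviation "f \<equiv> pg_vec G"
abbreviation "A \<equiv> ineq_mat G"
abbreviation "b \<equiv> ineq_rhs G"
abbreviation "E \<equiv> eq_mat G"
abbreviation "e \<equiv> eq_rhs G"

lemma carriers [simp]:
  "F \<in> carrier_mat n n" "f \<in> carrier_vec n" "A \<in> carrier_mat m n" "E \<in> carrier_mat q n"
  "b \<in> carrier_vec m" "e \<in> carrier_vec q" "A\<^sup>T \<in> carrier_mat n m" "E\<^sup>T \<in> carrier_mat n q"
  using valid by (auto simp: valid_game_def pg_mat_def pg_vec_def)

lemma dims [simp]:
  "dim_row F = n" "dim_col F = n" "dim_vec f = n" "dim_row A = m" "dim_row E = q"
  using carriers carrier_matD carrier_vecD by blast+

lemma mult_carriers [simp]:
  "x \<in> carrier_vec n \<Longrightarrow> F *\<^sub>v x \<in> carrier_vec n"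
  "x \<in> carrier_vec n \<Longrightarrow> A *\<^sub>v x \<in> carrier_vec m"
  "x \<in> carrier_vec n \<Longrightarrow> E *\<^sub>v x \<in> carrier_vec q"
  "l \<in> carrier_vec m \<Longrightarrow> A\<^sup>T *\<^sub>v l \<in> carrier_vec n"
  "v \<in> carrier_vec q \<Longrightarrow> E\<^sup>T *\<^sub>v v \<in> carrier_vec n"
  by (auto intro: mult_mat_vec_carrier carriers)

text \<open>The pseudogradient is affine, so comparing its values at \<open>d\<close> and at the
  origin cancels \<open>f\<close> and leaves only the linear part.\<close>

lemma pg_mat_nonneg:
  assumes [simp]: "d \<in> carrier_vec n"
  shows "d \<bullet> (F *\<^sub>v d) \<ge> 0"
proof -
  have "0 \<le> (pseudogradient G d - pseudogradient G (0\<^sub>v n)) \<bullet> (d - 0\<^sub>v n)"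
    using monotone assms zero_carrier_vec[of n] unfolding monotone_game_def by blast
  also have "pseudogradient G d - pseudogradient G (0\<^sub>v n) = F *\<^sub>v d"
  proof -
    have "F *\<^sub>v 0\<^sub>v n = 0\<^sub>v n"
      by (intro eq_vecI) (auto simp: pg_mat_def)
    then show ?thesis
      unfolding pseudogradient_def by (intro eq_vecI) (auto simp: pg_vec_def pg_mat_def)
  qed
  also have "d - 0\<^sub>v n = d"
    by (intro eq_vecI) auto
  finally show ?thesis
    by (subst comm_scalar_prod[of _ n]) auto
qed

text \<open>A matrix and its transpose have the same quadratic form. This lets \<open>F\<close>
  stand for its symmetric part in the objective, where stationarity can be applied.\<close>

lemma quadratic_form_pg_sym:
  assumes x: "x \<in> carrier_vec n"
  shows "x \<bullet> (pg_sym G *\<^sub>v x) = x \<bullet> (F *\<^sub>v x)"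
proof -
  note [simp] = x carrier_vecD[OF x]
  have FT [simp]: "F\<^sup>T \<in> carrier_mat n n" "F\<^sup>T *\<^sub>v x \<in> carrier_vec n"
    by (auto intro: mult_mat_vec_carrier[of _ n n])
  have "pg_sym G *\<^sub>v x = (1 / 2) \<cdot>\<^sub>v ((F + F\<^sup>T) *\<^sub>v x)"
    unfolding pg_sym_def by (intro eq_vecI) (auto simp: pg_mat_def)
  also have "(F + F\<^sup>T) *\<^sub>v x = F *\<^sub>v x + F\<^sup>T *\<^sub>v x"
    by (intro add_mult_distrib_mat_vec[of _ n n]) auto
  finally have "x \<bullet> (pg_sym G *\<^sub>v x) = (x \<bullet> (F *\<^sub>v x) + x \<bullet> (F\<^sup>T *\<^sub>v x)) / 2"
    by (simp add: scalar_prod_add_distrib[of _ n] scalar_prod_smult_distrib[of _ n])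
  also have "x \<bullet> (F\<^sup>T *\<^sub>v x) = (F\<^sup>T *\<^sub>v x) \<bullet> x"
    by (rule comm_scalar_prod[of _ n]) auto
  also have "\<dots> = x \<bullet> (F *\<^sub>v x)"
    by (rule transpose_vec_mult_scalar[of _ n n]) auto
  finally show ?thesis
    by simp
qed

section \<open>Stationarity and the complementarity gap\<close>

text \<open>Pairing stationarity with a direction \<open>d\<close> and moving the transposes across
  the scalar product. The choice \<open>d = x\<close> evaluates the objective;
  \<open>d = y - x\<close> gives the first-order change under a deviation.\<close>

lemma stationarity_scalar_prod:
  assumes "qp_feasible G (x, l, v)" and [simp]: "d \<in> carrier_vec n"
  shows "d \<bullet> (F *\<^sub>v x + f) = - (l \<bullet> (A *\<^sub>v d)) - v \<bullet> (E *\<^sub>v d)"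
proof -
  have [simp]: "x \<in> carrier_vec n" "l \<in> carrier_vec m" "v \<in> carrier_vec q"
    and stat: "F *\<^sub>v x + f + A\<^sup>T *\<^sub>v l + E\<^sup>T *\<^sub>v v = 0\<^sub>v n"
    using assms(1) by (auto simp: qp_feasible_def primal_dual_space_def)
  have "d \<bullet> (F *\<^sub>v x + f + A\<^sup>T *\<^sub>v l + E\<^sup>T *\<^sub>v v) = 0"
    by (simp add: stat)
  moreover have "d \<bullet> (F *\<^sub>v x + f + A\<^sup>T *\<^sub>v l + E\<^sup>T *\<^sub>v v) =
      d \<bullet> (F *\<^sub>v x + f) + d \<bullet> (A\<^sup>T *\<^sub>v l) + d \<bullet> (E\<^sup>T *\<^sub>v v)"
    by (simp add: scalar_prod_add_distrib[of _ n])
  moreover have "d \<bullet> (A\<^sup>T *\<^sub>v l) = l \<bullet> (A *\<^sub>v d)"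
    using transpose_vec_mult_scalar[of A m n d l]
    by (subst comm_scalar_prod[of _ n]) auto
  moreover have "d \<bullet> (E\<^sup>T *\<^sub>v v) = v \<bullet> (E *\<^sub>v d)"
    using transpose_vec_mult_scalar[of E q n d v]
    by (subst comm_scalar_prod[of _ n]) auto
  ultimately show ?thesis
    by simp
qed

text \<open>By stationarity in direction \<open>x\<close>, the part
  \<open>x \<bullet> (F *\<^sub>v x) + f \<bullet> x\<close> contributes
  \<open>- (v \<bullet> e)\<close>, which cancels the linear term in \<open>v\<close>, and
  \<open>- (l \<bullet> (A *\<^sub>v x))\<close>, which joins \<open>b \<bullet> l\<close> to form
  the gap.\<close>

lemma qp_objective_feasible:
  assumes "qp_feasible G (x, l, v)"
  shows "qp_objective G \<rho> (x, l, v) = l \<bullet> (b - A *\<^sub>v x) + \<rho> / 2 * (x \<bullet> x + l \<bullet> l + v \<bullet> v)"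
proof -
  have [simp]: "x \<in> carrier_vec n" "l \<in> carrier_vec m" "v \<in> carrier_vec q"
    and Ex: "E *\<^sub>v x = e"
    using assms by (auto simp: qp_feasible_def primal_dual_space_def)
  have "x \<bullet> (F *\<^sub>v x) + f \<bullet> x = x \<bullet> (F *\<^sub>v x + f)"
    by (simp add: scalar_prod_add_distrib[of _ n] comm_scalar_prod[of f n])
  also have "\<dots> = - (l \<bullet> (A *\<^sub>v x)) - v \<bullet> e"
    using stationarity_scalar_prod[OF assms, of x] Ex by simp
  finally show ?thesis
    by (simp add: qp_objective_def vec_norm_square quadratic_form_pg_sym
        scalar_prod_minus_distrib[of _ m] comm_scalar_prod[of b m] comm_scalar_prod[of e q])
qed

lemma gap_nonneg:
  assumes "qp_feasible G (x, l, v)"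
  shows "l \<bullet> (b - A *\<^sub>v x) \<ge> 0"
proof -
  have [simp]: "x \<in> carrier_vec n" "l \<in> carrier_vec m"
    and "0\<^sub>v m \<le> l" "A *\<^sub>v x \<le> b"
    using assms by (auto simp: qp_feasible_def primal_dual_space_def)
  then have "l \<bullet> (A *\<^sub>v x) \<le> l \<bullet> b"
    by (intro scalar_prod_le_mono[of m]) auto
  then show ?thesis
    by (simp add: scalar_prod_minus_distrib[of _ m])
qed

section \<open>Unilateral deviations and approximate equilibria\<close>

text \<open>The cost is quadratic, so its second-order expansion at \<open>x\<close> is exact. The
  step vanishes outside the block of player \<open>i\<close>, so only rows on which \<open>F\<close>
  and the player's own matrix agree contribute; the second-order term is then nonnegative and is
  dropped.\<close>

lemma cost_deviate:
  assumes i: "i < num_players G" and x: "x \<in> carrier_vec n"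
    and y: "y \<in> carrier_vec n"
    and same: "\<And>k. k < n \<Longrightarrow> \<not> (offset G i \<le> k \<and> k < offset G (Suc i)) \<Longrightarrow> y $ k = x $ k"
  shows "cost G i x + (y - x) \<bullet> (F *\<^sub>v x + f) \<le> cost G i y"
proof -
  define d where "d = y - x"
  let ?Q = "cost_mat G i" and ?c = "cost_vec G i"
  have Q [simp]: "?Q \<in> carrier_mat n n" and c [simp]: "?c \<in> carrier_vec n" and sym: "?Q\<^sup>T = ?Q"
    using valid i by (auto simp: valid_game_def)
  have Qc [simp]: "?Q *\<^sub>v z \<in> carrier_vec n" if "z \<in> carrier_vec n" for z
    using that by (rule mult_mat_vec_carrier[OF Q])
  have d [simp]: "d \<in> carrier_vec n"
    using x y by (simp add: d_def)
  have y_eq: "y = x + d"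
    using x y by (intro eq_vecI) (auto simp: d_def)
  note [simp] = x carrier_vecD[OF x]
  \<comment> \<open>Scalar products with \<open>d\<close> see only the coordinates of player
    \<open>i\<close>.\<close>
  have block: "d \<bullet> w = d \<bullet> w'"
    if w: "w \<in> carrier_vec n" "w' \<in> carrier_vec n"
      "\<And>k. k < n \<Longrightarrow> offset G i \<le> k \<Longrightarrow> k < offset G (Suc i) \<Longrightarrow> w $ k = w' $ k" for w w'
  proof -
    have "d $ k * w $ k = d $ k * w' $ k" if "k < n" for k
      using w(3) same that y by (cases "offset G i \<le> k \<and> k < offset G (Suc i)") (auto simp: d_def)
    then show ?thesis
      using w carrier_vecD[OF w(1)] carrier_vecD[OF w(2)] unfolding scalar_prod_def
      by (intro sum.cong) auto
  qed
  have mult: "(?Q *\<^sub>v z) $ k = (F *\<^sub>v z) $ k"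
    if "k < n" "offset G i \<le> k" "k < offset G (Suc i)" for k z
    using row_pg_mat[OF valid i that(2,3)] that(1) carrier_matD[OF Q] by simp
  have "d \<bullet> (?Q *\<^sub>v x + ?c) = d \<bullet> (F *\<^sub>v x + f)"
  proof (rule block)
    fix k assume k: "k < n" "offset G i \<le> k" "k < offset G (Suc i)"
    then have "f $ k = ?c $ k"
      using owner_eq[OF i k(2,3)] by (simp add: pg_vec_def)
    then show "(?Q *\<^sub>v x + ?c) $ k = (F *\<^sub>v x + f) $ k"
      using mult[OF k] k by (simp add: carrier_vecD[OF c] del: index_mult_mat_vec)
  qed auto
  moreover have "d \<bullet> (?Q *\<^sub>v d) = d \<bullet> (F *\<^sub>v d)"
    using mult by (intro block) auto
  \<comment> \<open>Symmetry of \<open>?Q\<close> makes the two cross terms equal, so the factor one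
    half in the cost disappears from the gradient \<open>?Q *\<^sub>v x + ?c\<close>.\<close>
  moreover have "x \<bullet> (?Q *\<^sub>v d) = d \<bullet> (?Q *\<^sub>v x)"
    using transpose_vec_mult_scalar[of ?Q n n d x] sym
    by (simp add: comm_scalar_prod[of d n])
  then have "cost G i y = cost G i x + d \<bullet> (?Q *\<^sub>v x + ?c) + d \<bullet> (?Q *\<^sub>v d) / 2"
    by (simp add: cost_def y_eq mult_add_distrib_mat_vec[of _ n n] scalar_prod_add_distrib[of _ n]
        add_scalar_prod_distrib[of _ n] comm_scalar_prod[of ?c n d] field_simps)
  ultimately show ?thesis
    using pg_mat_nonneg[OF d] by (simp flip: d_def)
qed

lemma strategy_set_if_qp_feasible: "qp_feasible G (x, l, v) \<Longrightarrow> x \<in> strategy_set G"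
  by (simp add: qp_feasible_def primal_dual_space_def strategy_set_def)

text \<open>Feasibility alone turns the gap into an error certificate; optimality will only serve to
  make the gap small.\<close>

lemma approx_GNE_gap:
  assumes feas: "qp_feasible G (x, l, v)"
  shows "approx_GNE G (l \<bullet> (b - A *\<^sub>v x)) x"
  unfolding approx_GNE_def
proof (intro conjI allI impI ballI)
  show "x \<in> strategy_set G"
    using feas by (rule strategy_set_if_qp_feasible)
  fix i z
  assume i: "i < num_players G" and z: "z \<in> carrier_vec (block_dim G i)"
    and dev: "deviate G i z x \<in> strategy_set G"
  define y where "y = deviate G i z x"
  have [simp]: "x \<in> carrier_vec n" "l \<in> carrier_vec m" "v \<in> carrier_vec q"
    and Ex: "E *\<^sub>v x = e" and l: "0\<^sub>v m \<le> l"
    using feas by (auto simp: qp_feasible_def primal_dual_space_def)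
  have y [simp]: "y \<in> carrier_vec n" and Ey: "E *\<^sub>v y = e" and Ay: "A *\<^sub>v y \<le> b"
    using dev by (auto simp: strategy_set_def y_def)
  \<comment> \<open>Both points satisfy the equality constraints, so
    \<open>E *\<^sub>v (y - x)\<close> is zero and the multiplier \<open>v\<close> drops
    out.\<close>
  have "(y - x) \<bullet> (F *\<^sub>v x + f) = l \<bullet> (A *\<^sub>v x) - l \<bullet> (A *\<^sub>v y)"
    by (simp add: stationarity_scalar_prod[OF feas] mult_minus_distrib_mat_vec[of _ m n]
        mult_minus_distrib_mat_vec[of _ q n] scalar_prod_minus_distrib[of _ m] Ex Ey
        scalar_prod_minus_distrib[of _ q])
  moreover have "l \<bullet> (A *\<^sub>v y) \<le> l \<bullet> b"
    using l Ay by (intro scalar_prod_le_mono[of m]) auto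
  moreover have "cost G i x + (y - x) \<bullet> (F *\<^sub>v x + f) \<le> cost G i y"
    using i by (intro cost_deviate) (auto simp: y_def deviate_def)
  ultimately show "cost G i x \<le> cost G i (deviate G i z x) + l \<bullet> (b - A *\<^sub>v x)"
    by (simp add: scalar_prod_minus_distrib[of _ m] flip: y_def)
qed

section \<open>Convexity, closedness and continuity of the quadratic program\<close>

lemma qp_feasible_mid:
  assumes "qp_feasible G (x, l, v)" "qp_feasible G (x', l', v')"
  shows "qp_feasible G (vec_mid x x', vec_mid l l', vec_mid v v')"
proof -
  have [simp]: "x \<in> carrier_vec n" "l \<in> carrier_vec m" "v \<in> carrier_vec q"
    "x' \<in> carrier_vec n" "l' \<in> carrier_vec m" "v' \<in> carrier_vec q"
    and stat: "F *\<^sub>v x + f + A\<^sup>T *\<^sub>v l + E\<^sup>T *\<^sub>v v = 0\<^sub>v n"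
      "F *\<^sub>v x' + f + A\<^sup>T *\<^sub>v l' + E\<^sup>T *\<^sub>v v' = 0\<^sub>v n"
    and E: "E *\<^sub>v x = e" "E *\<^sub>v x' = e" and A: "A *\<^sub>v x \<le> b" "A *\<^sub>v x' \<le> b"
    and l: "0\<^sub>v m \<le> l" "0\<^sub>v m \<le> l'"
    using assms by (auto simp: qp_feasible_def primal_dual_space_def)
  \<comment> \<open>The constant \<open>f\<close> is written as \<open>vec_mid f f\<close> so that
    the whole stationarity expression commutes with midpoints.\<close>
  have "F *\<^sub>v vec_mid x x' + vec_mid f f + A\<^sup>T *\<^sub>v vec_mid l l' + E\<^sup>T *\<^sub>v vec_mid v v' =
      vec_mid (F *\<^sub>v x + f + A\<^sup>T *\<^sub>v l + E\<^sup>T *\<^sub>v v) (F *\<^sub>v x' + f + A\<^sup>T *\<^sub>v l' + E\<^sup>T *\<^sub>v v')"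
    by (simp add: mult_mat_vec_mid[of F n n] mult_mat_vec_mid[of _ n m] mult_mat_vec_mid[of _ n q]
        vec_mid_add[of _ n])
  then have "F *\<^sub>v vec_mid x x' + f + A\<^sup>T *\<^sub>v vec_mid l l' + E\<^sup>T *\<^sub>v vec_mid v v' = 0\<^sub>v n"
    by (simp add: stat vec_mid_same[of _ n])
  moreover have "E *\<^sub>v vec_mid x x' = e"
    by (simp add: mult_mat_vec_mid[of _ q n] E vec_mid_same[of _ q])
  moreover have "A *\<^sub>v vec_mid x x' \<le> b"
  proof -
    have "vec_mid (A *\<^sub>v x) (A *\<^sub>v x') \<le> vec_mid b b"
      by (rule vec_mid_mono[OF A]) (rule carriers)+
    then show ?thesis
      by (simp only: mult_mat_vec_mid[OF carriers(3)] vec_mid_same[OF carriers(5)]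
          \<open>x \<in> carrier_vec n\<close> \<open>x' \<in> carrier_vec n\<close>)
  qed
  moreover have "0\<^sub>v m \<le> vec_mid l l'"
    using vec_mid_mono[OF l \<open>l \<in> carrier_vec m\<close> \<open>l' \<in> carrier_vec m\<close>]
    by (simp only: vec_mid_same[OF zero_carrier_vec])
  ultimately show ?thesis
    by (simp add: qp_feasible_def primal_dual_space_def)
qed

text \<open>The constant is the regularization weight \<open>\<rho> / 2\<close> times the factor 1/4
  of the parallelogram identity. The corresponding defect of the form of \<open>F\<close> has the
  right sign by monotonicity and is discarded.\<close>

lemma qp_objective_mid:
  assumes feas: "qp_feasible G (x, l, v)" "qp_feasible G (x', l', v')"
  shows "qp_objective G \<rho> (vec_mid x x', vec_mid l l', vec_mid v v') \<le>
    (qp_objective G \<rho> (x, l, v) + qp_objective G \<rho> (x', l', v')) / 2 -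
    \<rho> / 8 * ((x - x') \<bullet> (x - x') + (l - l') \<bullet> (l - l') + (v - v') \<bullet> (v - v'))"
proof -
  have [simp]: "x \<in> carrier_vec n" "l \<in> carrier_vec m" "v \<in> carrier_vec q"
    "x' \<in> carrier_vec n" "l' \<in> carrier_vec m" "v' \<in> carrier_vec q"
    using feas by (auto simp: qp_feasible_def primal_dual_space_def)
  have "(x - x') \<bullet> (F *\<^sub>v (x - x')) \<ge> 0"
    by (intro pg_mat_nonneg) simp
  then show ?thesis
    by (simp add: qp_objective_def vec_norm_square quadratic_form_pg_sym quadratic_form_mid[of _ n]
        scalar_prod_mid[of f n] scalar_prod_mid[of b m] scalar_prod_mid[of e q]
        scalar_prod_self_mid[of _ n] scalar_prod_self_mid[of _ m] scalar_prod_self_mid[of _ q]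
        field_simps)
qed

text \<open>All constraints are affine equations or weak inequalities, so they survive
  coordinatewise limits; equations do so because a constant sequence has only one limit.\<close>

lemma qp_feasible_lim:
  assumes feas: "\<And>k. qp_feasible G (x k, l k, v k)"
    and x: "vec_lim n x x'" and l: "vec_lim m l l'" and v: "vec_lim q v v'"
  shows "qp_feasible G (x', l', v')"
proof -
  have "vec_lim n (\<lambda>k. F *\<^sub>v x k + f + A\<^sup>T *\<^sub>v l k + E\<^sup>T *\<^sub>v v k)
      (F *\<^sub>v x' + f + A\<^sup>T *\<^sub>v l' + E\<^sup>T *\<^sub>v v')"
    by (intro vec_lim_add vec_lim_const vec_lim_mult_mat_vec[OF _ x] vec_lim_mult_mat_vec[OF _ l]
        vec_lim_mult_mat_vec[OF _ v] carriers)
  then have "vec_lim n (\<lambda>k. 0\<^sub>v n) (F *\<^sub>v x' + f + A\<^sup>T *\<^sub>v l' + E\<^sup>T *\<^sub>v v')"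
    using feas by (simp add: qp_feasible_def)
  then have "F *\<^sub>v x' + f + A\<^sup>T *\<^sub>v l' + E\<^sup>T *\<^sub>v v' = 0\<^sub>v n"
    by (rule vec_lim_unique[OF _ vec_lim_const]) simp
  moreover have "vec_lim q (\<lambda>k. e) (E *\<^sub>v x')"
    using vec_lim_mult_mat_vec[OF carriers(4) x] feas by (simp add: qp_feasible_def)
  then have "E *\<^sub>v x' = e"
    by (rule vec_lim_unique[OF _ vec_lim_const]) simp
  moreover have "A *\<^sub>v x' \<le> b"
    using feas by (intro vec_lim_le[OF vec_lim_mult_mat_vec[OF carriers(3) x] vec_lim_const])
      (auto simp: qp_feasible_def)
  moreover have "0\<^sub>v m \<le> l'"
    using feas by (intro vec_lim_le[OF vec_lim_const l]) (auto simp: qp_feasible_def)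
  ultimately show ?thesis
    using x l v by (simp add: qp_feasible_def primal_dual_space_def vec_lim_def)
qed

lemma qp_objective_lim:
  assumes x: "vec_lim n x x'" and l: "vec_lim m l l'" and v: "vec_lim q v v'"
  shows "(\<lambda>k. qp_objective G \<rho> (x k, l k, v k)) \<longlonglongrightarrow> qp_objective G \<rho> (x', l', v')"
proof -
  have "pg_sym G \<in> carrier_mat n n"
    by (simp add: pg_sym_def)
  then show ?thesis
    unfolding qp_objective_def vec_norm_square prod.case
    by (intro tendsto_intros tendsto_scalar_prod[OF x] tendsto_scalar_prod[OF l]
        tendsto_scalar_prod[OF v] tendsto_scalar_prod[OF vec_lim_const x]
        tendsto_scalar_prod[OF vec_lim_const l] tendsto_scalar_prod[OF vec_lim_const v]
        vec_lim_mult_mat_vec[OF _ x] x l v carriers)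
qed

section \<open>The minimizer and its gap\<close>

lemma ex1_qp_solution:
  assumes \<rho>: "\<rho> > 0" and feas: "qp_feasible G p0"
  shows "\<exists>!p. is_qp_solution G \<rho> p"
proof -
  define mid where "mid = (\<lambda>(x, l, v) (x', l', v'). (vec_mid x x', vec_mid l l', vec_mid v v'))"
  define d :: "real vec \<times> real vec \<times> real vec \<Rightarrow> _ \<Rightarrow> real" where
    "d = (\<lambda>(x, l, v) (x', l', v').
       (x - x') \<bullet> (x - x') + (l - l') \<bullet> (l - l') + (v - v') \<bullet> (v - v'))"
  show ?thesis
    unfolding is_qp_solution_def
  proof (rule ex1_is_arg_min_midpoint_convex[where s = p0
        and mid = mid and d = d and c = "\<rho> / 8"])
    \<comment> \<open>On the feasible set the objective is the nonnegative gap plus squares; this is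
      what bounds it from below.\<close>
    show "qp_objective G \<rho> p \<ge> 0" if p: "qp_feasible G p" for p
    proof -
      obtain x l v where [simp]: "p = (x, l, v)"
        by (cases p)
      show ?thesis
        using p gap_nonneg[of x l v] \<rho>
        by (simp add: qp_objective_feasible scalar_prod_self_nonneg)
    qed
    show "qp_feasible G (mid p r)" if "qp_feasible G p" "qp_feasible G r" for p r
      using that by (cases p, cases r) (simp add: mid_def qp_feasible_mid)
    show "qp_objective G \<rho> (mid p r) \<le>
        (qp_objective G \<rho> p + qp_objective G \<rho> r) / 2 - \<rho> / 8 * d p r"
      if "qp_feasible G p" "qp_feasible G r" for p r
      using that unfolding mid_def d_def by (cases p, cases r) (simp only: prod.case qp_objective_mid)
    show "p = r" if p: "qp_feasible G p" and r: "qp_feasible G r" and "d p r \<le> 0" for p r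
    proof -
      have eq: "y = y'"
        if y: "y \<in> carrier_vec k" "y' \<in> carrier_vec k" "(y - y') \<bullet> (y - y') \<le> 0"
        for y y' :: "real vec" and k
      proof (rule eq_vecI)
        fix i assume "i < dim_vec y'"
        then have i: "i < k"
          using y by simp
        have "((y - y') $ i)\<^sup>2 \<le> (y - y') \<bullet> (y - y')"
          using y i by (intro square_index_le_scalar_prod) auto
        also note y(3)
        finally have "(y - y') $ i = 0"
          by simp
        then show "y $ i = y' $ i"
          using y i by simp
      qed (use y in auto)
      obtain x l v x' l' v' where [simp]: "p = (x, l, v)" "r = (x', l', v')"
        by (cases p, cases r)
      \<comment> \<open>Three nonnegative summands with nonpositive sum are each
        nonpositive.\<close>
      have "(x - x') \<bullet> (x - x') \<le> 0" "(l - l') \<bullet> (l - l') \<le> 0" "(v - v') \<bullet> (v - v') \<le> 0"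
        using \<open>d p r \<le> 0\<close> scalar_prod_self_nonneg[of "x - x'"] scalar_prod_self_nonneg[of "l - l'"]
          scalar_prod_self_nonneg[of "v - v'"] by (simp_all add: d_def)
      then show ?thesis
        using p r by (auto simp: qp_feasible_def primal_dual_space_def intro: eq)
    qed
    show "\<exists>p. qp_feasible G p \<and> (\<lambda>k. qp_objective G \<rho> (u k)) \<longlonglongrightarrow> qp_objective G \<rho> p"
      if u: "\<And>k. qp_feasible G (u k)"
        and C: "\<And>\<epsilon>. \<epsilon> > 0 \<Longrightarrow> \<exists>N. \<forall>j\<ge>N. \<forall>k\<ge>N. d (u j) (u k) < \<epsilon>" for u
    proof -
      define x l v where "x k = fst (u k)" and "l k = fst (snd (u k))" and "v k = snd (snd (u k))" for k
      have u_eq: "u k = (x k, l k, v k)" for k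
        by (simp add: x_def l_def v_def)
      have cv: "x k \<in> carrier_vec n" "l k \<in> carrier_vec m" "v k \<in> carrier_vec q" for k
        using u[of k] by (auto simp: u_eq qp_feasible_def primal_dual_space_def)
      have d_ge: "(x j - x k) \<bullet> (x j - x k) \<le> d (u j) (u k)"
        "(l j - l k) \<bullet> (l j - l k) \<le> d (u j) (u k)"
        "(v j - v k) \<bullet> (v j - v k) \<le> d (u j) (u k)" for j k
        by (simp_all add: d_def u_eq scalar_prod_self_nonneg)
      obtain x' l' v' where "vec_lim n x x'" "vec_lim m l l'" "vec_lim q v v'"
        using Cauchy_imp_vec_lim[OF cv(1) d_ge(1) C] Cauchy_imp_vec_lim[OF cv(2) d_ge(2) C]
          Cauchy_imp_vec_lim[OF cv(3) d_ge(3) C] by auto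
      then have "qp_feasible G (x', l', v')"
        "(\<lambda>k. qp_objective G \<rho> (u k)) \<longlonglongrightarrow> qp_objective G \<rho> (x', l', v')"
        using u unfolding u_eq by (auto intro: qp_feasible_lim qp_objective_lim)
      then show ?thesis
        by blast
    qed
  qed (use \<rho> feas in auto)
qed

lemma qp_solution:
  assumes \<rho>: "\<rho> > 0" and kkt: "joint_KKT G (x', l', v')"
    and sol: "qp_solution G \<rho> = (x, l, v)"
  shows "qp_feasible G (x, l, v)"
    and "l \<bullet> (b - A *\<^sub>v x) \<le> \<rho> / 2 * ((vec_norm x')\<^sup>2 + (vec_norm l')\<^sup>2 + (vec_norm v')\<^sup>2)"
proof -
  have feas': "qp_feasible G (x', l', v')"
    using kkt by (simp add: joint_KKT_def qp_feasible_def)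
  \<comment> \<open>The KKT triple shows that the program is feasible, so the unique minimizer
    exists and the description in \<open>qp_solution\<close> denotes it.\<close>
  have "is_qp_solution G \<rho> (x, l, v)"
    using theI'[OF ex1_qp_solution[OF \<rho> feas']] sol by (simp add: qp_solution_def)
  then have feas: "qp_feasible G (x, l, v)"
    and le: "qp_objective G \<rho> (x, l, v) \<le> qp_objective G \<rho> (x', l', v')"
    using feas' by (auto simp: is_qp_solution_def is_arg_min_linorder)
  show "qp_feasible G (x, l, v)"
    by (rule feas)
  have "l' \<bullet> (b - A *\<^sub>v x') = 0"
  proof -
    have "x' \<in> carrier_vec n" "l' \<in> carrier_vec m"
      using feas' by (auto simp: qp_feasible_def primal_dual_space_def)
    then show ?thesis
      using kkt by (simp add: joint_KKT_def scalar_prod_minus_distrib[of _ m])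
  qed
  \<comment> \<open>At the KKT triple only the regularization is left; at the minimizer the
    regularization is nonnegative and may be dropped, leaving the gap.\<close>
  moreover have "\<rho> / 2 * (x \<bullet> x + l \<bullet> l + v \<bullet> v) \<ge> 0"
    using \<rho> by (simp add: scalar_prod_self_nonneg)
  ultimately show "l \<bullet> (b - A *\<^sub>v x) \<le>
      \<rho> / 2 * ((vec_norm x')\<^sup>2 + (vec_norm l')\<^sup>2 + (vec_norm v')\<^sup>2)"
    using le unfolding qp_objective_feasible[OF feas] qp_objective_feasible[OF feas'] vec_norm_square
    by linarith
qed

end

theorem proposition4p1:
  fixes G :: lq_game and \<rho> :: real and x_star l_star v_star :: "real vec"
  assumes "valid_game G"
    and "monotone_game G"
    and "\<rho> > 0"
    and "joint_KKT G (x_star, l_star, v_star)"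
  shows "(\<exists>!p. is_qp_solution G \<rho> p) \<and>
    fst (qp_solution G \<rho>) \<in> strategy_set G \<and>
    approx_GNE G (eps G \<rho>) (fst (qp_solution G \<rho>)) \<and>
    eps G \<rho> \<le> \<rho> / 2 * ((vec_norm x_star)\<^sup>2 + (vec_norm l_star)\<^sup>2 + (vec_norm v_star)\<^sup>2) \<and>
    eps G \<in> O[at_right 0](\<lambda>r. r)"
proof -
  interpret monotone_lq_game G
    using assms by unfold_locales
  define K where "K = (vec_norm x_star)\<^sup>2 + (vec_norm l_star)\<^sup>2 + (vec_norm v_star)\<^sup>2"
  \<comment> \<open>The KKT triple does not depend on the regularization weight, so the same
    \<open>K\<close> works for every \<open>r > 0\<close>; this uniformity gives the linear
    rate.\<close>
  have bounds: "0 \<le> eps G r \<and> eps G r \<le> r / 2 * K" if "r > 0" for r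
  proof -
    obtain x l v where sol: "qp_solution G r = (x, l, v)"
      by (cases "qp_solution G r")
    show ?thesis
      using qp_solution[OF that assms(4) sol] gap_nonneg[of x l v]
      by (simp add: eps_def sol K_def)
  qed
  \<comment> \<open>Nonnegativity of the gap turns the upper bound into one on the absolute
    value.\<close>
  have "norm (eps G r) \<le> K / 2 * norm r" if "r > 0" for r
    using bounds[OF that] that by (simp add: mult.commute)
  then have "eventually (\<lambda>r. norm (eps G r) \<le> K / 2 * norm r) (at_right 0)"
    by (rule eventually_mono[OF eventually_at_right_less])
  then have "eps G \<in> O[at_right 0](\<lambda>r. r)"
    by (rule bigoI)
  moreover have "qp_feasible G (x_star, l_star, v_star)"
    using assms(4) by (simp add: joint_KKT_def qp_feasible_def)
  then have "\<exists>!p. is_qp_solution G \<rho> p"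
    by (rule ex1_qp_solution[OF assms(3)])
  moreover obtain x l v where sol: "qp_solution G \<rho> = (x, l, v)"
    by (cases "qp_solution G \<rho>")
  note feas = qp_solution(1)[OF assms(3,4) sol]
  have "fst (qp_solution G \<rho>) \<in> strategy_set G"
    using strategy_set_if_qp_feasible[OF feas] by (simp add: sol)
  moreover have "approx_GNE G (eps G \<rho>) (fst (qp_solution G \<rho>))"
    using approx_GNE_gap[OF feas] by (simp add: sol eps_def)
  ultimately show ?thesis
    using bounds[OF assms(3)] by (simp add: K_def)
qed

end
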